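(* Let $n \geq 19$ be an integer and set $r = \lfloor (n-1)/2 \rfloor - 1$. Let $\mathcal{H}$ be an $n$-vertex $r$-uniform hypergraph that has a hamiltonian Berge cycle $C$. If every vertex of $\mathcal{H}$ is contained in at least $5(r-1)+2$ edges of $E(\mathcal{H}) \setminus E(C)$, then $\mathcal{H}$ is pancyclic.
   Context: A hypergraph $\mathcal{H}$ has a vertex set $V(\mathcal{H})$ and an edge set $E(\mathcal{H})$ of subsets of $V(\mathcal{H})$; it is $r$-uniform if every edge has exactly $r$ vertices. A Berge cycle of length $k$ consists of $k$ distinct vertices $v_0,\dots,v_{k-1}$ and $k$ distinct edges $e_0,\dots,e_{k-1}$ such that $\{v_i,v_{i+1}\}\subseteq e_i$ for all $i$ (indices modulo $k$); $E(C)$ denotes the set of edges of the Berge cycle $C$. A hamiltonian Berge cycle in an $n$-vertex hypergraph is a Berge cycle of length $n$. An $n$-vertex hypergraph is pancyclic if it contains Berge cycles of every length from $2$ to $n$. *)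

theory Defs
  imports Main
begin

text \<open>The edges of a hypergraph form a set, so there are no repeated edges.\<close>

definition hypergraph :: "'a set \<Rightarrow> 'a set set \<Rightarrow> bool" where
  "hypergraph V E \<longleftrightarrow> finite V \<and> E \<subseteq> Pow V"

definition uniform :: "nat \<Rightarrow> 'a set set \<Rightarrow> bool" where
  "uniform r E \<longleftrightarrow> (\<forall>e\<in>E. card e = r)"

text \<open>A Berge cycle is represented by the list of its vertices \<open>v\<^sub>0, \<dots>, v\<^sub>k\<^sub>-\<^sub>1\<close> and the
  list of its edges \<open>e\<^sub>0, \<dots>, e\<^sub>k\<^sub>-\<^sub>1\<close>.  For \<open>k = 2\<close> this means two distinct vertices
  that lie together in two distinct edges.\<close>

type_synonym 'a cycle = "'a list \<times> 'a set list"

definition cycle_vertices :: "'a cycle \<Rightarrow> 'a list" where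
  "cycle_vertices C = fst C"

definition cycle_edges :: "'a cycle \<Rightarrow> 'a set list" where
  "cycle_edges C = snd C"

definition berge_cycle :: "'a set \<Rightarrow> 'a set set \<Rightarrow> nat \<Rightarrow> 'a cycle \<Rightarrow> bool" where
  "berge_cycle V E k C \<longleftrightarrow>
     length (cycle_vertices C) = k \<and> distinct (cycle_vertices C) \<and> set (cycle_vertices C) \<subseteq> V \<and>
     length (cycle_edges C) = k \<and> distinct (cycle_edges C) \<and> set (cycle_edges C) \<subseteq> E \<and>
     (\<forall>i<k. {cycle_vertices C ! i, cycle_vertices C ! ((i + 1) mod k)} \<subseteq> cycle_edges C ! i)"

definition hamiltonian_berge_cycle :: "'a set \<Rightarrow> 'a set set \<Rightarrow> 'a cycle \<Rightarrow> bool" where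
  "hamiltonian_berge_cycle V E C \<longleftrightarrow> berge_cycle V E (card V) C"

definition pancyclic :: "'a set \<Rightarrow> 'a set set \<Rightarrow> bool" where
  "pancyclic V E \<longleftrightarrow> (\<forall>k\<in>{2..card V}. \<exists>C. berge_cycle V E k C)"

end

theory Submission
  imports Defs
begin

text \<open>Suppose that there is no Berge cycle of length \<open>d + 1\<close> for some \<open>2 \<le> d \<le> n - 2\<close>, and let \<open>H\<close> be
  the set of edges outside of \<open>C\<close>.  One or two arcs of \<open>C\<close>, closed up by distinct edges of \<open>H\<close>, never
  form a cycle of this length.  In particular no edge of \<open>H\<close> contains two vertices at distance \<open>d\<close>
  along \<open>C\<close>.  Comparing the neighbourhoods of two consecutive vertices by Bondy's bijection, and using
  that an edge of \<open>H\<close> is a clique on almost half of the vertices, one finds near every vertex a set \<open>K\<close> of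
  \<open>r + 2\<close> vertices any two of which lie in two common edges of \<open>H\<close>.  The set \<open>K\<close> is disjoint from its
  shift by \<open>d\<close>; hence \<open>n = 2r + 4\<close> and the shift of \<open>K\<close> is its complement.  Closing an arc that begins at
  the start of a run of \<open>K\<close> by one more vertex of \<open>K\<close> shows that the runs of \<open>K\<close> and of its complement
  all have length \<open>n - d\<close>.  A second such set, found near the complement of \<open>K\<close>, is a rotation of \<open>K\<close>,
  and one chord in each of the two sets produces a cycle of length \<open>d + 1\<close> after all.\<close>

section \<open>Berge paths and their closing to a Berge cycle\<close>

definition berge_path :: "'a list \<Rightarrow> 'a set list \<Rightarrow> bool" where
  "berge_path xs es \<longleftrightarrow>
     length xs = Suc (length es) \<and> (\<forall>i<length es. {xs ! i, xs ! Suc i} \<subseteq> es ! i)"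

lemma berge_path_rev:
  assumes "berge_path xs es"
  shows "berge_path (rev xs) (rev es)"
proof -
  have "{rev xs ! i, rev xs ! Suc i} \<subseteq> rev es ! i" if "i < length es" for i
  proof -
    define j where "j = length es - Suc i"
    have "j < length es" "rev es ! i = es ! j" "rev xs ! i = xs ! Suc j" "rev xs ! Suc i = xs ! j"
      using that assms by (auto simp: j_def rev_nth berge_path_def Suc_diff_Suc)
    then show ?thesis
      using assms by (auto simp: berge_path_def)
  qed
  then show ?thesis
    using assms by (simp add: berge_path_def)
qed

lemma berge_path_append:
  assumes xs: "berge_path xs es" and ys: "berge_path ys fs" and e: "{last xs, hd ys} \<subseteq> e"
  shows "berge_path (xs @ ys) (es @ e # fs)"
proof -
  have len: "length xs = Suc (length es)" "length ys = Suc (length fs)"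
    using xs ys by (auto simp: berge_path_def)
  then have "xs \<noteq> []" "ys \<noteq> []" by auto
  then have ends: "last xs = xs ! length es" "hd ys = ys ! 0"
    using len by (simp_all add: last_conv_nth hd_conv_nth)
  have "{(xs @ ys) ! i, (xs @ ys) ! Suc i} \<subseteq> (es @ e # fs) ! i"
    if i: "i < length (es @ e # fs)" for i
  proof -
    have "i < length es \<or> i = length es \<or>
        i = Suc (length es) + (i - Suc (length es)) \<and> i - Suc (length es) < length fs"
      using i by auto
    then consider "i < length es" | "i = length es"
      | j where "i = Suc (length es) + j" "j < length fs"
      by blast
    then show ?thesis
    proof cases
      case 1
      then show ?thesis using xs len by (auto simp: berge_path_def nth_append)
    next
      case 2
      then show ?thesis using e ends len by (auto simp: nth_append)
    next
      case 3
      then show ?thesis using ys len by (auto simp: berge_path_def nth_append)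
    qed
  qed
  then show ?thesis
    using len by (simp add: berge_path_def)
qed

lemma berge_cycle_of_path:
  assumes path: "berge_path xs es" and f: "{last xs, hd xs} \<subseteq> f"
    and "distinct xs" "set xs \<subseteq> V" "distinct (es @ [f])" "set (es @ [f]) \<subseteq> E"
  shows "berge_cycle V E (length xs) (xs, es @ [f])"
proof -
  have len: "length xs = Suc (length es)"
    using path by (auto simp: berge_path_def)
  then have "xs \<noteq> []" by auto
  then have ends: "last xs = xs ! length es" "hd xs = xs ! 0"
    using len by (simp_all add: last_conv_nth hd_conv_nth)
  have "{xs ! i, xs ! ((i + 1) mod length xs)} \<subseteq> (es @ [f]) ! i" if "i < length xs" for i
  proof (cases "i < length es")
    case True
    then show ?thesis using path len by (auto simp: berge_path_def nth_append)
  next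
    case False
    then have "i = length es" using that len by simp
    then show ?thesis using f ends len by (auto simp: nth_append)
  qed
  then show ?thesis
    using assms len by (simp add: berge_cycle_def cycle_vertices_def cycle_edges_def)
qed

text \<open>In a set of \<open>r + 1\<close> vertices an edge of size \<open>r\<close> is determined
  by the vertex that it leaves out, which is one of the \<open>r\<close> vertices other than
  \<open>w\<close>. In a smaller set only the whole set can be an edge.\<close>

lemma card_star_le:
  assumes "finite W" "card W \<le> r + 1" "1 \<le> r"
    and F: "\<And>e. e \<in> F \<Longrightarrow> w \<in> e \<and> e \<subseteq> W \<and> card e = r"
  shows "card F \<le> r"
proof (cases "card W \<le> r")
  case True
  have "F \<subseteq> {W}"
  proof
    fix e assume "e \<in> F"
    then have "e = W"
      using F[of e] True card_seteq[OF assms(1), of e] by simp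
    then show "e \<in> {W}" by simp
  qed
  then show ?thesis
    using assms(3) card_mono[of "{W}" F] by simp
next
  case False
  then have W: "card W = r + 1" using assms(2) by simp
  have "F \<subseteq> (\<lambda>x. W - {x}) ` (W - {w})"
  proof
    fix e assume "e \<in> F"
    note e = F[OF this]
    then have "card (W - e) = 1"
      using W card_Diff_subset[of e W] finite_subset[OF _ assms(1), of e] by simp
    then obtain x where x: "W - e = {x}" by (auto simp: card_1_singleton_iff)
    then have "e = W - {x}" "x \<in> W - {w}" using e by auto
    then show "e \<in> (\<lambda>x. W - {x}) ` (W - {w})" by blast
  qed
  then have le: "card F \<le> card (W - {w})"
    by (meson assms(1) card_image_le card_mono finite_Diff finite_imageI order_trans)
  show ?thesis
  proof (cases "F = {}")
    case False
    then have "w \<in> W" using F by blast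
    then show ?thesis using le W assms(1) by simp
  qed simp
qed

section \<open>Arcs of the cycle closed up by edges of \<open>H\<close>\<close>

locale missing_length =
  fixes V :: "'a set" and E H :: "'a set set" and v :: "int \<Rightarrow> 'a" and c :: "int \<Rightarrow> 'a set"
    and n r :: nat and d :: int
  assumes finV: "finite V" and cardV: "card V = n"
    and n_cases: "n = 2 * r + 3 \<or> n = 2 * r + 4" and r_ge: "8 \<le> r"
    and v_in: "v i \<in> V" and v_eq: "v i = v j \<longleftrightarrow> i mod int n = j mod int n"
    and c_in: "c i \<in> E" and c_eq: "c i = c j \<longleftrightarrow> i mod int n = j mod int n"
    and vc: "v i \<in> c i" "v (i + 1) \<in> c i"
    and H_sub: "H \<subseteq> E" and c_notin: "c i \<notin> H"
    and H_V: "e \<in> H \<Longrightarrow> e \<subseteq> V" and H_card: "e \<in> H \<Longrightarrow> card e = r"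
    and deg: "x \<in> V \<Longrightarrow> 5 * (r - 1) + 2 \<le> card {e \<in> H. x \<in> e}"
    and d_ge: "2 \<le> d" and d_le: "d \<le> int n - 2"
    and missing: "\<not> berge_cycle V E (nat (d + 1)) C"
begin

lemma v_add_n [simp]: "v (i + int n) = v i"
  by (simp add: v_eq)

lemma inj_on_v: "S \<subseteq> {a..<a + int n} \<Longrightarrow> inj_on v S"
proof (rule inj_onI)
  fix i j assume S: "S \<subseteq> {a..<a + int n}" "i \<in> S" "j \<in> S" and "v i = v j"
  then have "int n dvd i - j" by (simp add: v_eq mod_eq_dvd_iff)
  moreover have "\<bar>i - j\<bar> < int n" using subsetD[OF S(1) S(2)] subsetD[OF S(1) S(3)] by auto
  ultimately show "i = j" using dvd_imp_le_int[of "i - j" "int n"] by auto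
qed

lemma inj_on_c: "S \<subseteq> {a..<a + int n} \<Longrightarrow> inj_on c S"
  using inj_on_v[of S a] by (auto simp: inj_on_def v_eq c_eq)

lemma v_neq: "i < j \<Longrightarrow> j < i + int n \<Longrightarrow> v i \<noteq> v j"
  using inj_on_v[of "{i, j}" i] by (auto simp: inj_on_def)

lemma arc_path:
  assumes "p \<le> q"
  shows "berge_path (map v [p..q]) (map c [p..q - 1])"
proof -
  have "v (p + int (Suc i)) \<in> c (p + int i)" for i
    using vc(2)[of "p + int i"] by (simp add: ac_simps)
  then show ?thesis
    using assms vc(1) by (auto simp: berge_path_def simp del: of_nat_Suc)
qed

lemma arc_ends:
  assumes "p \<le> q"
  shows "hd (map v [p..q]) = v p" "last (map v [p..q]) = v q"
  using assms by (simp_all add: hd_conv_nth last_conv_nth)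

lemma no_single:
  assumes "e \<in> H" "v i \<in> e" "v (i + d) \<in> e"
  shows False
proof -
  have pq: "i \<le> i + d" using d_ge by simp
  have "berge_cycle V E (length (map v [i..i + d])) (map v [i..i + d], map c [i..i + d - 1] @ [e])"
  proof (rule berge_cycle_of_path[OF arc_path[OF pq]])
    show "distinct (map v [i..i + d])"
      using d_le by (auto simp: distinct_map intro!: inj_on_v[of _ i])
    have *: "{i..i + d - 1} \<subseteq> {i..<i + int n}"
      using d_le by auto
    show "distinct (map c [i..i + d - 1] @ [e])"
      using d_le assms(1) c_notin inj_on_c[OF *] by (auto simp: distinct_map)
    show "{last (map v [i..i + d]), hd (map v [i..i + d])} \<subseteq> e"
      unfolding arc_ends[OF pq] using assms by simp
  qed (use assms(1) H_sub c_in v_in in auto)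
  then show False using missing d_ge by simp
qed

text \<open>The assumption \<open>len\<close> counts vertices: the arcs have
  \<open>q - p + 1\<close> and \<open>t - s + 1\<close> of them, together \<open>d + 1\<close>. Both
  arcs are traversed forwards, and either may be a single vertex.\<close>

lemma no_parallel:
  assumes ord: "p \<le> q" "q < s" "s \<le> t" "t < p + int n" and len: "(q - p) + (t - s) + 1 = d"
    and ef: "e \<in> H" "f \<in> H" "e \<noteq> f" and "v q \<in> e" "v s \<in> e" "v t \<in> f" "v p \<in> f"
  shows False
proof -
  let ?xs = "map v [p..q] @ map v [s..t]"
  let ?es = "map c [p..q - 1] @ e # map c [s..t - 1]"
  have path: "berge_path ?xs ?es"
    using berge_path_append[OF arc_path[OF ord(1)] arc_path[OF ord(3)], of e] assms
    by (simp add: arc_ends)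
  have "berge_cycle V E (length ?xs) (?xs, ?es @ [f])"
  proof (rule berge_cycle_of_path[OF path])
    show "{last ?xs, hd ?xs} \<subseteq> f"
      using ord assms arc_ends[OF ord(1)] arc_ends[OF ord(3)] by (simp add: hd_append last_append)
    have "inj_on v ({p..q} \<union> {s..t})"
      using ord by (intro inj_on_v[of _ p]) auto
    then have "distinct (map v ([p..q] @ [s..t]))"
      using ord by (simp only: distinct_map) auto
    then show "distinct ?xs" by simp
    have "inj_on c ({p..q - 1} \<union> {s..t - 1})"
      using ord by (intro inj_on_c[of _ p]) auto
    then have "distinct (map c ([p..q - 1] @ [s..t - 1]))"
      using ord by (simp only: distinct_map) auto
    then show "distinct (?es @ [f])"
      using ef c_notin by auto
  qed (use ef H_sub c_in v_in in auto)
  moreover have "length ?xs = nat (d + 1)" using ord len by simp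
  ultimately show False using missing by metis
qed

text \<open>Here the second arc is traversed backwards, so that \<open>e\<close> enters it at
  \<open>v t\<close> and \<open>f\<close> leaves it at \<open>v s\<close>.\<close>

lemma no_crossing:
  assumes ord: "p \<le> q" "q < s" "s \<le> t" "t < p + int n" and len: "(q - p) + (t - s) + 1 = d"
    and ef: "e \<in> H" "f \<in> H" "e \<noteq> f" and "v q \<in> e" "v t \<in> e" "v s \<in> f" "v p \<in> f"
  shows False
proof -
  let ?xs = "map v [p..q] @ rev (map v [s..t])"
  let ?es = "map c [p..q - 1] @ e # rev (map c [s..t - 1])"
  have path: "berge_path ?xs ?es"
    using berge_path_append[OF arc_path[OF ord(1)] berge_path_rev[OF arc_path[OF ord(3)]], of e] assms
    by (simp add: arc_ends hd_rev)
  have "berge_cycle V E (length ?xs) (?xs, ?es @ [f])"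
  proof (rule berge_cycle_of_path[OF path])
    show "{last ?xs, hd ?xs} \<subseteq> f"
      using ord assms arc_ends[OF ord(1)] arc_ends[OF ord(3)]
      by (simp add: hd_append last_append last_rev)
    have "inj_on v ({p..q} \<union> {s..t})"
      using ord by (intro inj_on_v[of _ p]) auto
    then have "distinct (map v ([p..q] @ [s..t]))"
      using ord by (simp only: distinct_map) auto
    then show "distinct ?xs" by simp
    have "inj_on c ({p..q - 1} \<union> {s..t - 1})"
      using ord by (intro inj_on_c[of _ p]) auto
    then have "distinct (map c ([p..q - 1] @ [s..t - 1]))"
      using ord by (simp only: distinct_map) auto
    then show "distinct (?es @ [f])"
      using ef c_notin by auto
  qed (use ef H_sub c_in v_in in auto)
  moreover have "length ?xs = nat (d + 1)" using ord len by simp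
  ultimately show False using missing by metis
qed

section \<open>Counting vertices by their positions on the cycle\<close>

lemma finH: "finite H"
  using finV H_V by (meson PowI finite_Pow_iff rev_finite_subset subsetI)

lemma range_v: "v ` {a..<a + int n} = V"
proof (rule card_seteq[OF finV])
  show "card V \<le> card (v ` {a..<a + int n})"
    by (simp add: card_image[OF inj_on_v[OF order_refl]] cardV)
qed (use v_in in auto)

lemma card_indices:
  assumes "W \<subseteq> V"
  shows "card {i \<in> {a..<a + int n}. v i \<in> W} = card W"
proof -
  have "v ` {i \<in> {a..<a + int n}. v i \<in> W} = W"
    using assms range_v[of a] by auto
  moreover have "inj_on v {i \<in> {a..<a + int n}. v i \<in> W}"
    by (rule inj_on_v[of _ a]) auto
  ultimately show ?thesis by (metis card_image)
qed

lemma card_indices_shift: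
  assumes "W \<subseteq> V"
  shows "card {i \<in> {a..<a + int n}. v (i + d) \<in> W} = card W"
proof -
  have "{i \<in> {a + d..<a + d + int n}. v i \<in> W}
      = (\<lambda>i. i + d) ` {i \<in> {a..<a + int n}. v (i + d) \<in> W}"
    (is "?L = ?g ` ?M")
  proof
    show "?L \<subseteq> ?g ` ?M"
    proof
      fix x assume "x \<in> ?L"
      then show "x \<in> ?g ` ?M" by (intro image_eqI[of _ _ "x - d"]) auto
    qed
  qed auto
  then have "card {i \<in> {a + d..<a + d + int n}. v i \<in> W}
      = card {i \<in> {a..<a + int n}. v (i + d) \<in> W}"
    by (simp add: card_image)
  then show ?thesis using card_indices[OF assms, of "a + d"] by simp
qed

lemma shift_meets:
  assumes "W \<subseteq> V" "n < 2 * card W"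
  obtains i where "v i \<in> W" "v (i + d) \<in> W"
proof -
  let ?I = "{i \<in> {0..<0 + int n}. v i \<in> W}" and ?J = "{i \<in> {0..<0 + int n}. v (i + d) \<in> W}"
  have "?I \<inter> ?J \<noteq> {}"
  proof
    assume "?I \<inter> ?J = {}"
    moreover have "finite ?I" "finite ?J" by (auto intro: finite_subset[of _ "{0..<0 + int n}"])
    ultimately have "card (?I \<union> ?J) = 2 * card W"
      unfolding mult_2 using card_indices[OF assms(1), of 0] card_indices_shift[OF assms(1), of 0]
      by (simp only: card_Un_disjoint)
    moreover have "card (?I \<union> ?J) \<le> card {0..<int n}"
      by (intro card_mono) auto
    ultimately show False using assms(2) by simp
  qed
  then show ?thesis using that by blast
qed

section \<open>Heavy sets: construction from stars, existence near every vertex\<close>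

definition heavy :: "'a set \<Rightarrow> bool" where
  "heavy K \<longleftrightarrow> K \<subseteq> V \<and> card K = r + 2 \<and>
     (\<forall>x\<in>K. \<forall>y\<in>K. x \<noteq> y \<longrightarrow> (\<exists>e\<in>H. \<exists>f\<in>H. e \<noteq> f \<and> {x, y} \<subseteq> e \<inter> f))"

text \<open>This is what the second common edge is for: a chord of a heavy set can avoid an edge
  \<open>f\<close> that the cycle already uses.\<close>

lemma heavy_edge:
  assumes "heavy K" "x \<in> K" "y \<in> K" "x \<noteq> y"
  obtains e where "e \<in> H" "e \<noteq> f" "x \<in> e" "y \<in> e"
proof -
  obtain e1 e2 where "e1 \<in> H" "e2 \<in> H" "e1 \<noteq> e2" "{x, y} \<subseteq> e1 \<inter> e2"
    using assms unfolding heavy_def by meson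
  then show ?thesis using that[of e1] that[of e2] by fastforce
qed

lemma heavy_of_star:
  assumes W: "W \<subseteq> V" "card W \<le> r + 2" and F: "F \<subseteq> H" "2 * r + 2 \<le> card F"
    and w: "\<And>e. e \<in> F \<Longrightarrow> w \<in> e \<and> e \<subseteq> W"
  shows "heavy W" "w \<in> W"
  \<comment> \<open>At most \<open>r\<close> of the edges avoid a given vertex of \<open>W\<close>, so at least two contain a given pair.\<close>
proof -
  have finW: "finite W" and finF: "finite F"
    using W F finV finH finite_subset by auto
  have star: "w \<in> e \<and> e \<subseteq> W \<and> card e = r" if "e \<in> F" for e
    using that w F H_card by auto
  have "F \<noteq> {}" using F(2) by auto
  then show "w \<in> W" using w by blast
  have W_card: "card W = r + 2"
  proof (rule ccontr)
    assume "card W \<noteq> r + 2"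
    then have "card F \<le> r"
      using W r_ge by (intro card_star_le[OF finW _ _ star]) auto
    then show False using F(2) by simp
  qed
  have miss: "card {e \<in> F. x \<notin> e} \<le> r" if "x \<in> W" for x
  proof (rule card_star_le[where W = "W - {x}" and w = w])
    show "card (W - {x}) \<le> r + 1" using that W_card finW by simp
  qed (use star finW r_ge in auto)
  have "\<exists>e\<in>H. \<exists>f\<in>H. e \<noteq> f \<and> {x, y} \<subseteq> e \<inter> f" if "x \<in> W" "y \<in> W" for x y
  proof -
    let ?B = "{e \<in> F. x \<in> e \<and> y \<in> e}"
    have "card F \<le> card (?B \<union> ({e \<in> F. x \<notin> e} \<union> {e \<in> F. y \<notin> e}))"
      using finF by (intro card_mono) auto
    also have "\<dots> \<le> card ?B + (card {e \<in> F. x \<notin> e} + card {e \<in> F. y \<notin> e})"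
      by (meson add_left_mono card_Un_le order_trans)
    finally have "2 \<le> card ?B" using miss[OF that(1)] miss[OF that(2)] F(2) by simp
    then have "\<not> card ?B \<le> Suc 0" by simp
    then obtain e f where "e \<in> ?B" "f \<in> ?B" "e \<noteq> f"
      using card_le_Suc0_iff_eq[of ?B] finF by auto
    then show ?thesis using F(1) by blast
  qed
  then show "heavy W" using W W_card by (simp add: heavy_def)
qed

text \<open>In a set \<open>W\<close> of \<open>r + 3\<close> vertices some two vertices have difference \<open>d\<close>, so that no edge of
  \<open>H\<close> contains both; half of the edges avoid the same one of the two.\<close>

lemma heavy_of_large_star:
  assumes W: "W \<subseteq> V" "card W \<le> r + 3" and F: "F \<subseteq> H" "4 * r + 3 \<le> card F"
    and w: "\<And>e. e \<in> F \<Longrightarrow> w \<in> e \<and> e \<subseteq> W"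
  shows "\<exists>K. heavy K \<and> w \<in> K"
proof (cases "card W \<le> r + 2")
  case True
  then show ?thesis using heavy_of_star[OF W(1) True F(1) _ w] F(2) by auto
next
  case False
  then have "card W = r + 3" using W by simp
  \<comment> \<open>Since \<open>2 * (r + 3)\<close> exceeds \<open>n\<close>, the set
    \<open>W\<close> meets its shift by \<open>d\<close>.\<close>
  then obtain i where i: "v i \<in> W" "v (i + d) \<in> W"
    using n_cases by (elim shift_meets[OF W(1), rotated]) auto
  have finW: "finite W" and finF: "finite F"
    using W F finV finH finite_subset by auto
  have drop: ?thesis if x: "x \<in> W" and "2 * r + 2 \<le> card {e \<in> F. x \<notin> e}" for x
  proof -
    let ?F = "{e \<in> F. x \<notin> e}"
    have "W - {x} \<subseteq> V" "card (W - {x}) \<le> r + 2" "?F \<subseteq> H"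
      using W F x finW by auto
    moreover have "w \<in> e \<and> e \<subseteq> W - {x}" if "e \<in> ?F" for e
      using w that by auto
    ultimately have "heavy (W - {x})" "w \<in> W - {x}"
      using heavy_of_star[of "W - {x}" ?F w] that(2) by blast+
    then show ?thesis by blast
  qed
  have "card F \<le> card ({e \<in> F. v i \<notin> e} \<union> {e \<in> F. v (i + d) \<notin> e})"
    using finF F(1) no_single by (intro card_mono) auto
  also have "\<dots> \<le> card {e \<in> F. v i \<notin> e} + card {e \<in> F. v (i + d) \<notin> e}"
    by (rule card_Un_le)
  \<comment> \<open>Two classes of at most \<open>2 * r + 1\<close> edges would account for only
    \<open>4 * r + 2\<close>.\<close>
  finally have "2 * r + 2 \<le> card {e \<in> F. v i \<notin> e} \<or> 2 * r + 2 \<le> card {e \<in> F. v (i + d) \<notin> e}"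
    using F(2) by linarith
  then show ?thesis using drop i by blast
qed

text \<open>Bondy's bijection: chords from \<open>v i\<close> to \<open>v (i + j)\<close> and from \<open>v (i + 1)\<close> to \<open>v (i + \<phi> j)\<close>
  close up to a cycle of length \<open>d + 1\<close>, crossing for \<open>j < d\<close> and together with the edge \<open>c i\<close>
  for \<open>j \<ge> d\<close>.\<close>

definition \<phi> :: "int \<Rightarrow> int" where
  "\<phi> j = (if j < d then j + int n - d else j - d + 2)"

lemma \<phi>_range: "j \<in> {2..int n - 1} \<Longrightarrow> \<phi> j \<in> {2..int n - 1}"
  using d_ge d_le by (auto simp: \<phi>_def)

text \<open>The offsets below \<open>d\<close> are translated onto the top \<open>d - 2\<close>
  places of the range, the others onto the places up to \<open>n - d + 1\<close>.\<close>

lemma inj_on_\<phi>: "inj_on \<phi> {2..int n - 1}"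
  by (rule inj_onI) (auto simp: \<phi>_def split: if_splits)

lemma \<phi>_chords:
  assumes j: "j \<in> {2..int n - 1}" and ef: "e \<in> H" "f \<in> H"
    and e: "v i \<in> e" "v (i + j) \<in> e" and f: "v (i + 1) \<in> f" "v (i + \<phi> j) \<in> f"
  shows "e = f"
proof (rule ccontr)
  assume "e \<noteq> f"
  show False
  proof (cases "j < d")
    case True
    show False
      using True j d_ge d_le e f \<open>e \<noteq> f\<close> ef
      by (intro no_crossing[of "i + 1" "i + j" "i + \<phi> j" "i + int n" e f]) (auto simp: \<phi>_def)
  next
    case False
    show False
      using False j d_ge d_le e f \<open>e \<noteq> f\<close> ef
      by (intro no_parallel[of i "i + 1" "i + \<phi> j" "i + j" f e]) (auto simp: \<phi>_def)
  qed
qed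

text \<open>As \<open>\<phi>\<close> maps \<open>S - X\<close> outside of \<open>T\<close>, the sets
  of offsets left at the two vertices have at most \<open>n - 2 - card X\<close> elements together.
  So at one of the two vertices the remaining edges form a star within few vertices.\<close>

lemma heavy_near: "\<exists>K. heavy K \<and> (v i \<in> K \<or> v (i + 1) \<in> K)"
proof -
  let ?R = "{2..int n - 1}"
  define A where "A = {e \<in> H. v i \<in> e}"
  define B where "B = {e \<in> H. v (i + 1) \<in> e}"
  define S where "S = {j \<in> ?R. \<exists>e\<in>A. v (i + j) \<in> e}"
  define T where "T = {j \<in> ?R. \<exists>f\<in>B. v (i + j) \<in> f}"
  \<comment> \<open>For \<open>j \<in> X\<close> a single edge contains all four of \<open>v i\<close>, \<open>v (i + j)\<close>, \<open>v (i + 1)\<close>, \<open>v (i + \<phi> j)\<close>,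
    so that discarding \<open>X\<close> costs at most \<open>card X\<close> edges at either vertex.\<close>
  define X where "X = {j \<in> S. \<phi> j \<in> T}"
  define A' where "A' = {e \<in> A. \<forall>j\<in>X. v (i + j) \<notin> e}"
  define B' where "B' = {f \<in> B. \<forall>j\<in>X. v (i + \<phi> j) \<notin> f}"
  \<comment> \<open>\<open>WA\<close> and \<open>WB\<close> are to contain all edges of
    \<open>A'\<close> and \<open>B'\<close>. The vertices \<open>v i\<close> and
    \<open>v (i + 1)\<close> are added because the range of offsets omits 0 and 1.\<close>
  define WA where "WA = insert (v i) (insert (v (i + 1)) ((\<lambda>j. v (i + j)) ` (S - X)))"
  define WB where "WB = insert (v i) (insert (v (i + 1)) ((\<lambda>j. v (i + j)) ` (T - \<phi> ` X)))"
  have sub: "S \<subseteq> ?R" "T \<subseteq> ?R" "X \<subseteq> S" "\<phi> ` X \<subseteq> T"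
    by (auto simp: S_def T_def X_def)
  have fin: "finite S" "finite T" "finite X" "finite A" "finite B"
    using sub finH by (auto simp: A_def B_def intro: finite_subset[OF _ finite_atLeastAtMost_int]
        dest: order_trans)
  have inj: "inj_on \<phi> S" using inj_on_\<phi> sub(1) inj_on_subset by blast
  have "card (\<phi> ` (S - X)) + card (T - \<phi> ` X) + card (\<phi> ` X)
      = card (\<phi> ` (S - X) \<union> ((T - \<phi> ` X) \<union> \<phi> ` X))"
  proof -
    have "\<phi> ` (S - X) \<inter> T = {}" by (auto simp: X_def)
    then have "\<phi> ` (S - X) \<inter> ((T - \<phi> ` X) \<union> \<phi> ` X) = {}" using sub(4) by blast
    moreover have "(T - \<phi> ` X) \<inter> \<phi> ` X = {}" by blast
    ultimately show ?thesis
      using fin by (simp add: card_Un_disjoint del: Un_Diff_cancel2)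
  qed
  also have "\<dots> \<le> card ?R"
    using sub \<phi>_range by (intro card_mono) (auto simp: subset_iff)
  finally have sum: "card (S - X) + card (T - \<phi> ` X) + card X \<le> n - 2"
    using card_image[OF inj_on_subset[OF inj, of "S - X"]] card_image[OF inj_on_subset[OF inj sub(3)]]
    by simp
  have "\<exists>g. \<forall>j\<in>X. (\<forall>e\<in>A. v (i + j) \<in> e \<longrightarrow> e = g j) \<and> (\<forall>f\<in>B. v (i + \<phi> j) \<in> f \<longrightarrow> f = g j)"
  proof (rule bchoice, rule ballI)
    fix j assume "j \<in> X"
    then obtain e f where e: "e \<in> A" "v (i + j) \<in> e" and f: "f \<in> B" "v (i + \<phi> j) \<in> f"
      and j: "j \<in> ?R"
      by (auto simp: X_def S_def T_def)
    have eq: "e' = f'" if "e' \<in> A" "v (i + j) \<in> e'" "f' \<in> B" "v (i + \<phi> j) \<in> f'" for e' f'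
      using \<phi>_chords[OF j, of e' f' i] that by (auto simp: A_def B_def)
    show "\<exists>g. (\<forall>e\<in>A. v (i + j) \<in> e \<longrightarrow> e = g) \<and> (\<forall>f\<in>B. v (i + \<phi> j) \<in> f \<longrightarrow> f = g)"
      using eq e f by (intro exI[of _ e]) metis
  qed
  then obtain g where g: "\<And>j e. j \<in> X \<Longrightarrow> e \<in> A \<Longrightarrow> v (i + j) \<in> e \<Longrightarrow> e = g j"
    "\<And>j f. j \<in> X \<Longrightarrow> f \<in> B \<Longrightarrow> v (i + \<phi> j) \<in> f \<Longrightarrow> f = g j" by metis
  have removed: "card A \<le> card A' + card X" "card B \<le> card B' + card X"
  proof -
    have "A \<subseteq> A' \<union> g ` X" "B \<subseteq> B' \<union> g ` X"
      unfolding A'_def B'_def using g by blast+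
    then have "card A \<le> card (A' \<union> g ` X)" "card B \<le> card (B' \<union> g ` X)"
      using fin by (auto intro!: card_mono simp: A'_def B'_def)
    then show "card A \<le> card A' + card X" "card B \<le> card B' + card X"
      using card_Un_le[of A' "g ` X"] card_Un_le[of B' "g ` X"] card_image_le[OF fin(3), of g]
      by linarith+
  qed
  have index: "\<exists>j\<in>?R. x = v (i + j)" if x: "x \<in> V" "x \<noteq> v i" "x \<noteq> v (i + 1)" for x
  proof -
    obtain l where l: "l \<in> {i..<i + int n}" "x = v l" using x(1) range_v[of i] by blast
    then have "l \<noteq> i" "l \<noteq> i + 1" using x by auto
    then show ?thesis using l by (intro bexI[of _ "l - i"]) auto
  qed
  have W: "WA \<subseteq> V" "WB \<subseteq> V" using v_in by (auto simp: WA_def WB_def)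
  have W_card: "card WA \<le> card (S - X) + 2" "card WB \<le> card (T - \<phi> ` X) + 2"
    unfolding WA_def WB_def
    using fin card_image_le[of "S - X" "\<lambda>j. v (i + j)"] card_image_le[of "T - \<phi> ` X" "\<lambda>j. v (i + j)"]
    by (auto simp: card_insert_if)
  have starA: "v i \<in> e \<and> e \<subseteq> WA" if "e \<in> A'" for e
  proof -
    have "x \<in> WA" if x: "x \<in> e" for x
    proof (cases "x = v i \<or> x = v (i + 1)")
      case False
      then obtain j where "j \<in> ?R" "x = v (i + j)"
        using index[of x] x H_V[of e] \<open>e \<in> A'\<close> unfolding A'_def A_def by blast
      then show ?thesis using x \<open>e \<in> A'\<close> by (auto simp: WA_def A'_def S_def)
    qed (auto simp: WA_def)
    then show ?thesis using that by (auto simp: A'_def A_def)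
  qed
  have starB: "v (i + 1) \<in> f \<and> f \<subseteq> WB" if "f \<in> B'" for f
  proof -
    have "x \<in> WB" if x: "x \<in> f" for x
    proof (cases "x = v i \<or> x = v (i + 1)")
      case False
      then obtain j where "j \<in> ?R" "x = v (i + j)"
        using index[of x] x H_V[of f] \<open>f \<in> B'\<close> unfolding B'_def B_def by blast
      then show ?thesis using x \<open>f \<in> B'\<close> by (auto simp: WB_def B'_def T_def)
    qed (auto simp: WB_def)
    then show ?thesis using that by (auto simp: B'_def B_def)
  qed
  have F: "A' \<subseteq> H" "B' \<subseteq> H" by (auto simp: A'_def A_def B'_def B_def)
  have degs: "5 * r - 3 \<le> card A" "5 * r - 3 \<le> card B"
    using deg[OF v_in, of i] deg[OF v_in, of "i + 1"] r_ge unfolding A_def B_def by linarith+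
  show ?thesis
  \<comment> \<open>If \<open>X\<close> is empty, no edge is lost, and the degree suffices for a
    star on \<open>r + 3\<close> vertices. Otherwise \<open>card X\<close> in \<open>sum\<close>
    lowers the bound to \<open>r + 2\<close> vertices, where fewer edges suffice.\<close>
  proof (cases "X = {}")
    case True
    then have "4 * r + 3 \<le> card A'" "4 * r + 3 \<le> card B'" using degs removed r_ge by auto
    moreover have "card WA \<le> r + 3 \<or> card WB \<le> r + 3" using sum W_card n_cases by linarith
    ultimately show ?thesis
      using heavy_of_large_star[OF W(1) _ F(1) _ starA] heavy_of_large_star[OF W(2) _ F(2) _ starB]
      by blast
  next
    case False
    then have "1 \<le> card X" using fin by (simp add: Suc_le_eq card_gt_0_iff)
    then have "card WA \<le> r + 2 \<or> card WB \<le> r + 2" using sum W_card n_cases by linarith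
    \<comment> \<open>At most \<open>n - 2 <= 2 * r + 2\<close> edges are lost, so at least
      \<open>3 * r - 5\<close> remain.\<close>
    moreover have "2 * r + 2 \<le> card A'" "2 * r + 2 \<le> card B'"
      using degs removed r_ge sum n_cases by linarith+
    ultimately show ?thesis
      using heavy_of_star[OF W(1) _ F(1) _ starA] heavy_of_star[OF W(2) _ F(2) _ starB]
      by blast
  qed
qed

section \<open>Runs of a heavy set along the cycle\<close>

abbreviation g :: int where
  "g \<equiv> int n - d"

text \<open>By \<open>no_single\<close> the positions of \<open>K\<close> and their shift are
  disjoint. Each set has \<open>r + 2\<close> elements and \<open>n <= 2 * r + 4\<close>, so
  together they fill the cycle.\<close>

lemma heavy_shift:
  assumes "heavy K"
  shows "v (i + d) \<in> K \<longleftrightarrow> v i \<notin> K"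
proof -
  have K: "K \<subseteq> V" "card K = r + 2" using assms by (auto simp: heavy_def)
  have not_both: "\<not> (v j \<in> K \<and> v (j + d) \<in> K)" for j
  proof
    assume j: "v j \<in> K \<and> v (j + d) \<in> K"
    have "v j \<noteq> v (j + d)" using d_ge d_le by (intro v_neq) auto
    then obtain e where "e \<in> H" "v j \<in> e" "v (j + d) \<in> e"
      using heavy_edge[OF assms] j by metis
    then show False by (rule no_single)
  qed
  let ?I = "{j \<in> {i..<i + int n}. v j \<in> K}" and ?J = "{j \<in> {i..<i + int n}. v (j + d) \<in> K}"
  have "?I \<inter> ?J = {}" using not_both by blast
  moreover have "finite ?I" "finite ?J" by (auto intro: finite_subset[of _ "{i..<i + int n}"])
  ultimately have "card (?I \<union> ?J) = 2 * (r + 2)"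
    unfolding mult_2 using card_indices[OF K(1), of i] card_indices_shift[OF K(1), of i] K(2)
    by (simp only: card_Un_disjoint)
  then have "card {i..<i + int n} \<le> card (?I \<union> ?J)" using n_cases by auto
  then have "?I \<union> ?J = {i..<i + int n}" by (intro card_seteq) auto
  moreover have "i \<in> {i..<i + int n}" using d_ge d_le by auto
  ultimately show ?thesis using not_both[of i] by blast
qed

text \<open>Modulo \<open>n\<close>, shifting by \<open>g\<close> undoes shifting by
  \<open>d\<close>.\<close>

lemma heavy_flip:
  assumes "heavy K"
  shows "v (i + g) \<in> K \<longleftrightarrow> v i \<notin> K"
  using heavy_shift[OF assms, of "i + g"] by (simp add: algebra_simps)

lemma heavy_period:
  assumes "heavy K"
  shows "v (i + 2 * g) \<in> K \<longleftrightarrow> v i \<in> K"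
  using heavy_flip[OF assms, of "i + g"] heavy_flip[OF assms, of i] by (simp add: algebra_simps)

lemma heavy_period_mult:
  assumes "heavy K"
  shows "v (i + 2 * g * z) \<in> K \<longleftrightarrow> v i \<in> K"
proof (induction z rule: int_induct[where k = 0])
  case (step1 z)
  then show ?case using heavy_period[OF assms, of "i + 2 * g * z"] by (simp add: algebra_simps)
next
  case (step2 z)
  then show ?case
    using heavy_period[OF assms, of "i + 2 * g * (z - 1)"] by (simp add: algebra_simps)
qed simp

definition start :: "'a set \<Rightarrow> int \<Rightarrow> bool" where
  "start K a \<longleftrightarrow> v a \<in> K \<and> v (a - 1) \<notin> K"

lemma ex_start:
  assumes "heavy K"
  shows "\<exists>a. start K a"
proof (rule ccontr)
  assume no: "\<nexists>a. start K a"
  obtain i where i: "v i \<in> K"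
    using heavy_flip[OF assms] by metis
  \<comment> \<open>Without a start, membership in \<open>K\<close> passes from each vertex to the
    one before it.\<close>
  have "v (i - int m) \<in> K" for m
    using no i by (induction m) (auto simp: start_def algebra_simps)
  then have "v (i - d) \<in> K" using d_ge by (metis int_nat_eq order_trans zero_le_numeral)
  then show False using heavy_shift[OF assms, of "i - d"] i by simp
qed

text \<open>The arc of \<open>d\<close> vertices starting at \<open>v a\<close> also ends in \<open>K\<close>; one more vertex of \<open>K\<close> outside of
  it would close a Berge cycle of the missing length.\<close>

lemma before_start:
  assumes K: "heavy K" and a: "start K a" and y: "1 \<le> y" "y \<le> g"
  shows "v (a - y) \<notin> K"
proof
  assume "v (a - y) \<in> K"
  moreover define u where "u = a - y + int n"
  ultimately have u: "v u \<in> K" by simp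
  have q: "v (a + d - 1) \<in> K"
    using heavy_shift[OF K, of "a - 1"] a by (simp add: start_def algebra_simps)
  have "v (a + d - 1) \<noteq> v u" using y d_ge by (intro v_neq) (auto simp: u_def)
  then obtain e where e: "e \<in> H" "v (a + d - 1) \<in> e" "v u \<in> e"
    using heavy_edge[OF K q u] by metis
  have "v a \<noteq> v u" using y d_ge by (intro v_neq) (auto simp: u_def)
  then obtain f where f: "f \<in> H" "f \<noteq> e" "v u \<in> f" "v a \<in> f"
    using heavy_edge[OF K u, of "v a"] a unfolding start_def by metis
  \<comment> \<open>The second arc is the single vertex \<open>v u\<close>; the bound
    \<open>y <= g\<close> places it after \<open>v (a + d - 1)\<close>.\<close>
  show False
    using y d_ge e f by (intro no_parallel[of a "a + d - 1" u u e f]) (auto simp: u_def)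
qed

text \<open>The \<open>g\<close> vertices before a start lie outside \<open>K\<close>, and each
  shift by \<open>g\<close> flips membership.\<close>

lemma start_block:
  assumes K: "heavy K" and a: "start K a" and y: "0 \<le> y" "y < g"
  shows "v (a + y) \<in> K" "v (a + g + y) \<notin> K" "v (a + 2 * g + y) \<in> K"
proof -
  show 1: "v (a + y) \<in> K"
    using before_start[OF K a, of "g - y"] heavy_flip[OF K, of "a - (g - y)"] y
    by (simp add: algebra_simps)
  then show "v (a + g + y) \<notin> K"
    using heavy_flip[OF K, of "a + y"] by (simp add: algebra_simps)
  show "v (a + 2 * g + y) \<in> K"
    using heavy_period[OF K, of "a + y"] 1 by (simp add: algebra_simps)
qed

lemma start_period: "heavy K \<Longrightarrow> start K (a + 2 * g * z) \<longleftrightarrow> start K a"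
  using heavy_period_mult[of K a z] heavy_period_mult[of K "a - 1" z]
  by (simp add: start_def algebra_simps)

text \<open>Otherwise \<open>v (a + int n)\<close>, which is \<open>v a\<close>, would fall into the
  block of non-members that begins at \<open>a + g\<close>.\<close>

lemma g_le: "2 * g \<le> int n"
proof (rule ccontr)
  assume big: "\<not> 2 * g \<le> int n"
  obtain K where K: "heavy K" using heavy_near by blast
  obtain a where a: "start K a" using ex_start[OF K] by blast
  have "v (a + int n) \<notin> K"
    using start_block(2)[OF K a, of "int n - g"] big d_ge by simp
  then show False using a by (simp add: start_def)
qed

text \<open>A cycle of length \<open>d + 1\<close> leaves out exactly \<open>g - 1\<close> vertices.
  In each case one chord within \<open>K\<close> and one within \<open>L\<close> are chosen to skip
  this many.\<close>

lemma no_two_blocks: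
  assumes K: "heavy K" "start K a" and L: "heavy L" "start L (a + m)" and m: "1 \<le> m" "m \<le> g"
  shows False
proof -
  have g2: "2 \<le> g" using d_le by simp
  have crossing: False
    if arcs: "p \<le> q" "q < s" "s \<le> t" "t < p + int n" "(q - p) + (t - s) + 1 = d"
      and MN: "heavy M" "v q \<in> M" "v t \<in> M" "heavy N" "v s \<in> N" "v p \<in> N"
    for p q s t M N
  proof -
    have "v q \<noteq> v t" "v p \<noteq> v s" using v_neq[of q t] v_neq[of p s] arcs by auto
    obtain e where e: "e \<in> H" "v q \<in> e" "v t \<in> e"
      using heavy_edge[OF MN(1-3) \<open>v q \<noteq> v t\<close>] by metis
    obtain f where f: "f \<in> H" "f \<noteq> e" "v p \<in> f" "v s \<in> f"
      using heavy_edge[OF MN(4,6,5) \<open>v p \<noteq> v s\<close>] by metis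
    show False using no_crossing[OF arcs e(1) f(1) _ e(2,3) f(4,3)] f(2) by blast
  qed
  have block: "v (a + y) \<in> K" "v (a + 2 * g + y) \<in> K" "v (a + m + y) \<in> L"
    "v (a + m + 2 * g + y) \<in> L" if "0 \<le> y" "y < g" for y
    using start_block[OF K] start_block[OF L] that by auto
  consider "3 \<le> g" "2 \<le> m" | "3 \<le> g" "m = 1" | "g = 2" "m = 1" | "g = 2" "m = 2"
    using g2 m by linarith
  then show False
  proof cases
    case 1
    have n: "v (a + m) \<noteq> v (a + m + (g - 1))" "v a \<noteq> v (a + 2)"
      using v_neq[of "a + m" "a + m + (g - 1)"] v_neq[of a "a + 2"] 1 d_ge by auto
    obtain e where e: "e \<in> H" "v (a + m) \<in> e" "v (a + m + (g - 1)) \<in> e"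
      using heavy_edge[OF L(1) _ _ n(1)] block(3)[of 0] block(3)[of "g - 1"] g2 by auto
    obtain f where f: "f \<in> H" "f \<noteq> e" "v a \<in> f" "v (a + 2) \<in> f"
      using heavy_edge[OF K(1) _ _ n(2)] block(1)[of 0] block(1)[of 2] 1 by auto
    \<comment> \<open>The chord \<open>f\<close> skips \<open>v (a + 1)\<close>, and
      \<open>e\<close> skips the \<open>g - 2\<close> inner vertices of the first block of
      \<open>L\<close>.\<close>
    show False
      using 1 m g_le e f
      by (intro no_parallel[of "a + 2" "a + m" "a + m + (g - 1)" "a + int n" e f]) auto
  next
    case 2
    have "v (a + g) \<in> L" "v (a + int n + 1) \<in> L" "v (a + 2 * g) \<in> K" "v (a + 2) \<in> K"
      using block(3)[of "g - 1"] block(3)[of 0] block(2)[of 0] block(1)[of 2] v_add_n[of "a + 1"] 2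
      by (simp_all add: algebra_simps)
    \<comment> \<open>Left out are the \<open>g - 1\<close> vertices strictly between
      \<open>v (a + g)\<close> and \<open>v (a + 2 * g)\<close>.\<close>
    then show False
      using 2 g_le K L by (intro crossing[of "a + 2" "a + g" "a + 2 * g" "a + int n + 1" L K]) auto
  next
    case 3
    \<comment> \<open>For \<open>g = 2\<close> the vertex \<open>v (a + 2)\<close> is no longer in
      \<open>K\<close>, and a single vertex has to be left out: \<open>v (a + 5)\<close> here,
      \<open>v (a + 6)\<close> in the last case.\<close>
    have "v (a + 4) \<in> K" "v (a + int n) \<in> K" "v (a + 6) \<in> L" "v (a + 1) \<in> L"
      using block(2)[of 0] block(1)[of 0] block(4)[of 1] block(3)[of 0] 3 by (simp_all add: add.commute)
    then show False
      using 3 n_cases r_ge K L by (intro crossing[of "a + 1" "a + 4" "a + 6" "a + int n" K L]) auto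
  next
    case 4
    have "v (a + 5) \<in> K" "v (a + int n + 1) \<in> K" "v (a + 7) \<in> L" "v (a + 2) \<in> L"
      using block(2)[of 1] block(1)[of 1] block(4)[of 1] block(3)[of 0] v_add_n[of "a + 1"] 4
      by (simp_all add: algebra_simps)
    then show False
      using 4 n_cases r_ge K L
      by (intro crossing[of "a + 2" "a + 5" "a + 7" "a + int n + 1" K L]) auto
  qed
qed

lemma no_missing_length: False
proof -
  have g2: "2 \<le> g" using d_le by simp
  obtain K where K: "heavy K" using heavy_near by blast
  obtain a where a: "start K a" using ex_start[OF K] by blast
  obtain L where L: "heavy L" and near: "v (a + g) \<in> L \<or> v (a + g + 1) \<in> L"
    using heavy_near by blast
  obtain b where b: "start L b" using ex_start[OF L] by blast
  define m where "m = (b - a) mod (2 * g)"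
  have m: "0 \<le> m" "m < 2 * g" using g2 by (auto simp: m_def)
  have "b = a + m + 2 * g * ((b - a) div (2 * g))"
    using mult_div_mod_eq[of "2 * g" "b - a"] by (simp add: m_def)
  then have Lm: "start L (a + m)" using start_period[OF L] b by metis
  \<comment> \<open>For \<open>m = 0\<close> both candidates \<open>v (a + g)\<close> and
    \<open>v (a + g + 1)\<close> would lie in a gap of \<open>L\<close>, which has at least two
    vertices.\<close>
  have "m \<noteq> 0"
    using start_block(2)[OF L, of a 0] start_block(2)[OF L, of a 1] Lm near g2 by auto
  show False
  proof (cases "m \<le> g")
    case True
    then show False using no_two_blocks[OF K a L Lm] m \<open>m \<noteq> 0\<close> by simp
  next
    case False
    \<comment> \<open>With the roles exchanged, the next start of \<open>K\<close> follows that of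
      \<open>L\<close> at distance \<open>2 * g - m < g\<close>.\<close>
    have "start K (a + m + (2 * g - m))" using start_period[OF K, of a 1] a by simp
    then show False using no_two_blocks[OF L Lm K, of "2 * g - m"] m False by auto
  qed
qed

end

lemma ex_berge_cycle_2:
  assumes "finite V" "H \<subseteq> E" "H \<subseteq> Pow V" and card: "\<And>e. e \<in> H \<Longrightarrow> 2 \<le> card e"
    and x: "x \<in> V" and deg: "card V \<le> card {e \<in> H. x \<in> e}"
  shows "\<exists>C. berge_cycle V E 2 C"
proof -
  let ?F = "{e \<in> H. x \<in> e}"
  have "\<exists>y\<in>V - {x}. y \<in> e" if "e \<in> ?F" for e
  proof (rule ccontr)
    assume "\<not> (\<exists>y\<in>V - {x}. y \<in> e)"
    then have "e \<subseteq> {x}" using that assms(3) by blast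
    then have "card e \<le> card {x}" by (intro card_mono) auto
    then show False using card that by force
  qed
  then obtain y where y: "\<And>e. e \<in> ?F \<Longrightarrow> y e \<in> V - {x} \<and> y e \<in> e" by metis
  have "card (y ` ?F) \<le> card (V - {x})"
    using y assms(1) by (intro card_mono) auto
  \<comment> \<open>Pigeonhole: more edges contain \<open>x\<close> than there are other vertices,
    so two of them share a second vertex.\<close>
  also have "\<dots> < card ?F"
    using deg x assms(1) card_gt_0_iff[of V] by (auto simp: card_Diff_singleton)
  finally have "\<not> inj_on y ?F" by (metis card_image less_irrefl)
  then obtain e f where ef: "e \<in> ?F" "f \<in> ?F" "e \<noteq> f" "y e = y f" by (auto simp: inj_on_def)
  have "berge_cycle V E (length [x, y e]) ([x, y e], [e] @ [f])"
    using ef y[OF ef(1)] y[OF ef(2)] x assms(2)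
    by (intro berge_cycle_of_path) (auto simp: berge_path_def)
  then show ?thesis by (auto simp: numeral_2_eq_2)
qed

theorem theorem2p5:
  fixes n r :: nat and V :: "'a set" and E :: "'a set set" and C :: "'a cycle"
  assumes "n \<ge> 19"
    and "r = (n - 1) div 2 - 1"
    and "hypergraph V E"
    and "card V = n"
    and "uniform r E"
    and "hamiltonian_berge_cycle V E C"
    and "\<forall>v\<in>V. card {e \<in> E - set (cycle_edges C). v \<in> e} \<ge> 5 * (r - 1) + 2"
  shows "pancyclic V E"
proof -
  define vs cs H where "vs = cycle_vertices C" and "cs = cycle_edges C" and "H = E - set cs"
  \<comment> \<open>Extending the cycle periodically to all integers lets arcs pass the index 0
    without wrap-around.\<close>
  define v c where "v i = vs ! nat (i mod int n)" and "c i = cs ! nat (i mod int n)" for i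
  have len: "length vs = n" "length cs = n" and dist: "distinct vs" "distinct cs"
    and sub: "set vs \<subseteq> V" "set cs \<subseteq> E"
    and edge: "\<And>i. i < n \<Longrightarrow> {vs ! i, vs ! ((i + 1) mod n)} \<subseteq> cs ! i"
    using assms(4,6) by (auto simp: hamiltonian_berge_cycle_def berge_cycle_def vs_def cs_def)
  have lt: "nat (i mod int n) < n" for i using assms(1) by (simp add: nat_less_iff)
  have eq: "nat (i mod int n) = nat (j mod int n) \<longleftrightarrow> i mod int n = j mod int n" for i j
    using assms(1) by (simp add: eq_nat_nat_iff)
  have suc: "nat ((i + 1) mod int n) = (nat (i mod int n) + 1) mod n" for i
  proof -
    have "int (nat ((i + 1) mod int n)) = int ((nat (i mod int n) + 1) mod n)"
      using assms(1) by (simp add: zmod_int mod_simps add.commute)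
    then show ?thesis by (simp only: of_nat_eq_iff)
  qed
  \<comment> \<open>The two forms of \<open>n\<close> are the odd and the even case of the
    floor.\<close>
  have r: "8 \<le> r" "n = 2 * r + 3 \<or> n = 2 * r + 4" using assms(1,2) by presburger+
  have H_deg: "5 * (r - 1) + 2 \<le> card {e \<in> H. x \<in> e}" if "x \<in> V" for x
    using assms(7) that by (simp add: H_def cs_def)
  have finV: "finite V" and EV: "E \<subseteq> Pow V" using assms(3) by (auto simp: hypergraph_def)
  have E_card: "card e = r" if "e \<in> E" for e using assms(5) that by (simp add: uniform_def)
  have "\<exists>C. berge_cycle V E k C" if k: "2 \<le> k" "k \<le> n" for k
  proof -
    \<comment> \<open>The arc argument needs \<open>d = k - 1\<close> between 2 and
      \<open>n - 2\<close>, so lengths 2 and \<open>n\<close> are treated apart.\<close>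
    consider "k = 2" | "k = n" | "3 \<le> k" "k < n" using k by linarith
    then show ?thesis
    proof cases
      case 1
      obtain x where x: "x \<in> V" using assms(1,4) by fastforce
      have "card V \<le> card {e \<in> H. x \<in> e}" using H_deg[OF x] r assms(4) by linarith
      then show ?thesis
        using ex_berge_cycle_2[OF finV, of H E x] x EV E_card r 1 by (auto simp: H_def)
    next
      case 2
      then show ?thesis using assms(4,6) unfolding hamiltonian_berge_cycle_def by blast
    next
      case 3
      show ?thesis
      proof (rule ccontr)
        assume no: "\<nexists>C. berge_cycle V E k C"
        interpret missing_length V E H v c n r "int k - 1"
        proof
          show "v i \<in> V" for i using sub lt len by (auto simp: v_def)
          show "c i \<in> E" for i using sub lt len by (auto simp: c_def)
          show "v i = v j \<longleftrightarrow> i mod int n = j mod int n" for i j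
            using lt len dist eq by (simp add: v_def nth_eq_iff_index_eq)
          show "c i = c j \<longleftrightarrow> i mod int n = j mod int n" for i j
            using lt len dist eq by (simp add: c_def nth_eq_iff_index_eq)
          show "v i \<in> c i" "v (i + 1) \<in> c i" for i
            using edge[OF lt, of i] by (auto simp: v_def c_def suc)
          show "c i \<notin> H" for i using lt len by (auto simp: c_def H_def)
          show "e \<subseteq> V" "card e = r" if "e \<in> H" for e
            using that EV E_card by (auto simp: H_def)
          show "\<not> berge_cycle V E (nat (int k - 1 + 1)) C" for C using no by (cases C) simp
        qed (use finV assms(4) r H_deg 3 in \<open>auto simp: H_def\<close>)
        show False by (rule no_missing_length)
      qed
    qed
  qed
  then show ?thesis using assms(4) by (simp add: pancyclic_def)
qed

end
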